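(* Let $2\le k\le n$ and $\mathcal{B}_n^k=\{\{1\},\ldots,\{n\}\}\cup\{I\subseteq[n]: |I|\ge k\}$. The $q$-$h$-polynomial of the nestohedron $P_{\mathcal{B}_n^k}$ is \[ h_{\mathcal{B}_n^k}(t,q)=\sum_{A\in\binom{[n]}{n-k+1}}\ \sum_{\pi\in S_A} t^{\mathrm{des}(\pi)+|\{j\in[n]\setminus A: j>\pi_1\}|}\,q^{\mathrm{maj}(\pi)+\mathrm{des}(\pi)+|\{j\in[n]\setminus A: j>\pi_1\}|}. \] Moreover, \[ h_{\mathcal{B}_n^k}(t,q)=t^{n-1}q^{\frac{k^2-2kn-k+n^2+3n-2}{2}}\,h_{\mathcal{B}_n^k}(t^{-1},q^{-1}). \]
   Context: $\binom{[n]}{m}$ is the set of $m$-element subsets of $[n]$. For $A=\{a_1<\cdots<a_m\}$, $S_A$ is the set of permutations $\pi=\pi_1\cdots\pi_m$ of $A$ (words using each element once); $\mathrm{Des}(\pi)=\{i\in[m-1]:\pi_i>\pi_{i+1}\}$, $\mathrm{des}(\pi)=|\mathrm{Des}(\pi)|$, $\mathrm{maj}(\pi)=\sum_{i\in\mathrm{Des}(\pi)}i$. The nestohedron of a building set $\mathcal{B}$ on $[n]$ is $P_{\mathcal{B}}=\sum_{I\in\mathcal{B}}y_I\Delta_I\subset\mathbb{R}^n$ with $y_I>0$ and $\Delta_I=\mathrm{conv}\{e_i:i\in I\}$; it is a simple generalized permutohedron. Its normal fan (normal cone of a face = linear functionals maximized on the whole face), in $(\mathbb{R}^n)^\ast/(1,\ldots,1)$,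 is refined by the braid fan. For a full-dimensional cone $\sigma$, $Q_\sigma$ is the poset on $[n]$ with $i\le j$ iff $x_i\le x_j$ for all $x\in\sigma$; it is graded with minimal rank function $\rho_\sigma$ (rank function: $\rho\ge0$, $\rho(y)=\rho(x)+1$ when $y$ covers $x$; minimal: $\rho-1$ is not a rank function). $\mathrm{Des}(Q)=\{(i,j): j\text{ covers }i,\ i>j\}$, $\mathrm{des}(Q)=|\mathrm{Des}(Q)|$, $\mathrm{maj}(Q)=\sum_{(i,j)\in\mathrm{Des}(Q)}\rho(j)$. The $q$-$h$-polynomial is $h_{\mathcal{B}}(t,q)=\sum_\sigma t^{\mathrm{des}(Q_\sigma)}q^{\mathrm{maj}(Q_\sigma)}$ over full-dimensional cones $\sigma$ of the normal fan of $P_{\mathcal{B}}$. *)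

theory Defs
  imports "HOL-Analysis.Analysis" "HOL-Combinatorics.Multiset_Permutations"
    "HOL-Computational_Algebra.Polynomial"
begin

text \<open>
  The ground set \<open>[n]\<close> is a finite linearly ordered type \<open>'n\<close> with \<open>CARD('n) = n\<close>, so
  \<open>real^'n\<close> is \<open>n\<close>-space. A linear functional on it is identified with its coordinate vector
  \<open>x\<close>, acting by \<open>x \<bullet> p\<close>.
\<close>

subsection \<open>Nestohedra\<close>

definition simplex_of :: "'n::finite set \<Rightarrow> (real^'n) set" where
  "simplex_of I = convex hull ((\<lambda>i. axis i 1) ` I)"

text \<open>The outer sum is a Minkowski sum of sets (from \<open>HOL-Library.Set_Algebras\<close>).\<close>

definition nestohedron :: "('n::finite set \<Rightarrow> real) \<Rightarrow> 'n set set \<Rightarrow> (real^'n) set" where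
  "nestohedron y B = (\<Sum>I\<in>B. (\<lambda>v. y I *\<^sub>R v) ` simplex_of I)"

definition family_B :: "nat \<Rightarrow> 'n::finite set set" where
  "family_B k = {{i} | i. True} \<union> {I. k \<le> card I}"

subsection \<open>Normal fans\<close>

definition normal_cone :: "'a::euclidean_space set \<Rightarrow> 'a set \<Rightarrow> 'a set" where
  "normal_cone P F = {x. \<forall>p\<in>F. \<forall>q\<in>P. x \<bullet> q \<le> x \<bullet> p}"

definition normal_fan :: "'a::euclidean_space set \<Rightarrow> 'a set set" where
  "normal_fan P = {normal_cone P F | F. F face_of P \<and> F \<noteq> {}}"

text \<open>
  For a polytope in a hyperplane where the coordinate sum is constant, all normal cones are
  invariant under translation by multiples of \<open>(1,\<dots>,1)\<close>. A cone of the fan in the quotient by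
  that line is represented by its preimage in \<open>real^'n\<close>; it is full-dimensional
  in the quotient iff the preimage has dimension \<open>n\<close>.
\<close>

definition full_cones :: "'a::euclidean_space set \<Rightarrow> 'a set set" where
  "full_cones P = {\<sigma> \<in> normal_fan P. aff_dim \<sigma> = int DIM('a)}"

subsection \<open>Posets and their descent statistics\<close>

definition cone_le :: "(real^'n) set \<Rightarrow> 'n::finite \<Rightarrow> 'n \<Rightarrow> bool" where
  "cone_le \<sigma> i j \<longleftrightarrow> (\<forall>x\<in>\<sigma>. x $ i \<le> x $ j)"

text \<open>A poset on the whole type is given by its order relation \<open>Q\<close>;
  \<open>covered_by Q i j\<close> means that \<open>j\<close> covers \<open>i\<close>.\<close>

definition covered_by :: "('a \<Rightarrow> 'a \<Rightarrow> bool) \<Rightarrow> 'a \<Rightarrow> 'a \<Rightarrow> bool" where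
  "covered_by Q i j \<longleftrightarrow> Q i j \<and> i \<noteq> j \<and> (\<nexists>z. z \<noteq> i \<and> z \<noteq> j \<and> Q i z \<and> Q z j)"

text \<open>Rank functions are integer-valued so that \<open>\<rho> - 1\<close> is not truncated.\<close>

definition rank_function :: "('a \<Rightarrow> 'a \<Rightarrow> bool) \<Rightarrow> ('a \<Rightarrow> int) \<Rightarrow> bool" where
  "rank_function Q \<rho> \<longleftrightarrow> (\<forall>x. 0 \<le> \<rho> x) \<and> (\<forall>x y. covered_by Q x y \<longrightarrow> \<rho> y = \<rho> x + 1)"

definition minimal_rank :: "('a \<Rightarrow> 'a \<Rightarrow> bool) \<Rightarrow> 'a \<Rightarrow> int" where
  "minimal_rank Q = (THE \<rho>. rank_function Q \<rho> \<and> \<not> rank_function Q (\<lambda>x. \<rho> x - 1))"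

definition poset_Des :: "('a::linorder \<Rightarrow> 'a \<Rightarrow> bool) \<Rightarrow> ('a \<times> 'a) set" where
  "poset_Des Q = {(i, j). covered_by Q i j \<and> i > j}"

definition poset_des :: "('a::linorder \<Rightarrow> 'a \<Rightarrow> bool) \<Rightarrow> nat" where
  "poset_des Q = card (poset_Des Q)"

definition poset_maj :: "('a::linorder \<Rightarrow> 'a \<Rightarrow> bool) \<Rightarrow> nat" where
  "poset_maj Q = (\<Sum>(i, j)\<in>poset_Des Q. nat (minimal_rank Q j))"

subsection \<open>The q-h-polynomial\<close>

text \<open>Polynomials in \<open>t\<close> and \<open>q\<close> have type \<open>int poly poly\<close>: the outer variable is
  \<open>t\<close>, the inner one \<open>q\<close>.\<close>

definition tq_monom :: "nat \<Rightarrow> nat \<Rightarrow> int poly poly" where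
  "tq_monom a b = monom (monom 1 b) a"

definition tq_eval :: "int poly poly \<Rightarrow> 'a::field \<Rightarrow> 'a \<Rightarrow> 'a" where
  "tq_eval p t q = poly (poly (map_poly (map_poly of_int) p) [:t:]) q"

definition q_h_poly :: "('n::{finite,linorder} set \<Rightarrow> real) \<Rightarrow> 'n set set \<Rightarrow> int poly poly" where
  "q_h_poly y B = (\<Sum>\<sigma>\<in>full_cones (nestohedron y B).
     tq_monom (poset_des (cone_le \<sigma>)) (poset_maj (cone_le \<sigma>)))"

subsection \<open>Descent statistics of words\<close>

text \<open>Positions are numbered from 1: the letter at position \<open>i\<close> is \<open>w ! (i - 1)\<close>.\<close>

definition word_Des :: "'a::linorder list \<Rightarrow> nat set" where
  "word_Des w = {i \<in> {1..<length w}. w ! (i - 1) > w ! i}"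

definition word_des :: "'a::linorder list \<Rightarrow> nat" where
  "word_des w = card (word_Des w)"

definition word_maj :: "'a::linorder list \<Rightarrow> nat" where
  "word_maj w = \<Sum>(word_Des w)"

end

theory Submission imports Defs begin

text \<open>
  A functional \<open>x\<close> is maximized on \<open>\<Delta>\<^sub>I\<close> at the vertices of \<open>I\<close> on which \<open>x\<close> is largest. Hence the
  vertex of the nestohedron at which a generic \<open>x\<close> is maximal depends only on, and determines, the
  indices of the \<open>n - k + 1\<close> largest coordinates of \<open>x\<close> in their order. Listing them increasingly as a
  word \<open>w\<close>, the poset of the cone is the chain \<open>w\<close> with the other \<open>k - 1\<close> indices placed as an antichain
  below its first letter. An edge of the chain into \<open>w\<^sub>i\<close> contributes rank \<open>i\<close>, an edge into the first
  letter contributes rank \<open>1\<close>, which gives the formula. Relabelling the indices by the order-reversing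
  bijection of \<open>[n]\<close> turns descents into ascents, which gives the symmetry.
\<close>

subsection \<open>Full-dimensional normal cones\<close>

text \<open>If \<open>p\<close> tied with \<open>v\<close>, moving \<open>x\<close> slightly in the
  direction \<open>p - v\<close> would stay in the cone and yet favour \<open>p\<close>. So a
  functional interior to the normal cone of a point has that point as its only maximizer.\<close>

lemma normal_cone_interior_unique:
  assumes "x \<in> interior (normal_cone P {v})" "v \<in> P" "p \<in> P" "x \<bullet> p = x \<bullet> v"
  shows "p = v"
proof -
  obtain e where e: "e > 0" "ball x e \<subseteq> normal_cone P {v}"
    using assms(1) by (auto simp: mem_interior)
  define d where "d = p - v"
  have xd: "x \<bullet> d = 0"
    using assms(4) by (simp add: d_def inner_diff_right)
  \<comment> \<open>The step length keeps \<open>x + c *\<^sub>R d\<close> within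
    \<open>e / 2\<close> of \<open>x\<close>; the summand 1 keeps the denominator positive when
    \<open>d = 0\<close>.\<close>
  define c where "c = e / (2 * (norm d + 1))"
  have n: "norm d + 1 > 0" by (simp add: add_nonneg_pos)
  have c: "c > 0" using e(1) n by (simp add: c_def)
  have "c * (norm d + 1) = e / 2" using n by (simp add: c_def del: distrib_left_numeral)
  then have "c * norm d \<le> e / 2" using c by (simp add: distrib_left)
  then have "x + c *\<^sub>R d \<in> ball x e"
    using e(1) c by (simp add: dist_norm)
  then have "(x + c *\<^sub>R d) \<bullet> p \<le> (x + c *\<^sub>R d) \<bullet> v"
    using e(2) assms(3) by (auto simp: normal_cone_def)
  then have "(x + c *\<^sub>R d) \<bullet> d \<le> 0"
    by (simp add: d_def inner_diff_right)
  then have "c * (d \<bullet> d) \<le> 0"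
    using xd by (simp add: inner_add_left)
  then have "d \<bullet> d \<le> 0"
    using c by (simp add: mult_le_0_iff)
  then have "d = 0"
    using inner_gt_zero_iff[of d] by (metis not_le)
  then show ?thesis
    by (simp add: d_def)
qed

lemma convex_normal_cone: "convex (normal_cone P F)"
proof (rule convexI)
  fix x y and u v :: real
  assume xy: "x \<in> normal_cone P F" "y \<in> normal_cone P F" and uv: "0 \<le> u" "0 \<le> v"
  show "u *\<^sub>R x + v *\<^sub>R y \<in> normal_cone P F"
    unfolding normal_cone_def
  proof (safe)
    fix p q assume "p \<in> F" "q \<in> P"
    then have "x \<bullet> q \<le> x \<bullet> p" "y \<bullet> q \<le> y \<bullet> p"
      using xy by (auto simp: normal_cone_def)
    then show "(u *\<^sub>R x + v *\<^sub>R y) \<bullet> q \<le> (u *\<^sub>R x + v *\<^sub>R y) \<bullet> p"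
      using uv by (auto simp: inner_add_left intro!: add_mono mult_left_mono)
  qed
qed

text \<open>Full dimension of a convex cone gives an interior functional, whose unique maximizer
  forces the face to be a single point. Conversely such a functional exposes \<open>v\<close> as an
  extreme point. Afterwards only points of \<open>P\<close> matter, not faces.\<close>

lemma full_cones_eq:
  fixes P :: "'a::euclidean_space set"
  shows "full_cones P = {normal_cone P {v} | v. v \<in> P \<and> interior (normal_cone P {v}) \<noteq> {}}"
proof (intro subset_antisym subsetI)
  fix \<sigma> assume "\<sigma> \<in> full_cones P"
  then obtain F where F: "F face_of P" "F \<noteq> {}" "\<sigma> = normal_cone P F" "aff_dim \<sigma> = int DIM('a)"
    by (auto simp: full_cones_def normal_fan_def)
  obtain v where v: "v \<in> F" using F(2) by blast
  have FP: "F \<subseteq> P" using F(1) face_of_imp_subset by blast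
  have "interior \<sigma> \<noteq> {}"
    using F(3,4) convex_normal_cone[of P F] rel_interior_eq_empty[of \<sigma>]
    by (auto simp: interior_rel_interior_gen)
  then obtain x where x: "x \<in> interior (normal_cone P F)" using F(3) by blast
  have sub: "normal_cone P F \<subseteq> normal_cone P {v}"
    using v by (auto simp: normal_cone_def)
  have xv: "x \<in> interior (normal_cone P {v})"
    using x interior_mono[OF sub] by blast
  have "p = v" if "p \<in> F" for p
  proof -
    have "x \<in> normal_cone P F" using x interior_subset by blast
    then have "x \<bullet> p = x \<bullet> v"
      using that v FP by (intro antisym) (auto simp: normal_cone_def)
    then show ?thesis
      using normal_cone_interior_unique[OF xv] v that FP by blast
  qed
  then have "F = {v}" using v by blast
  then show "\<sigma> \<in> {normal_cone P {v} | v. v \<in> P \<and> interior (normal_cone P {v}) \<noteq> {}}"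
    using F(3) FP xv by blast
next
  fix \<sigma> assume "\<sigma> \<in> {normal_cone P {v} | v. v \<in> P \<and> interior (normal_cone P {v}) \<noteq> {}}"
  then obtain v x where v: "\<sigma> = normal_cone P {v}" "v \<in> P" "x \<in> interior (normal_cone P {v})"
    by blast
  have max: "x \<bullet> p \<le> x \<bullet> v" if "p \<in> P" for p
    using v(3) interior_subset that by (fastforce simp: normal_cone_def)
  have "v extreme_point_of P"
    unfolding extreme_point_of_def
  proof (intro conjI ballI notI)
    show "v \<in> P" by (fact v(2))
    fix a b assume ab: "a \<in> P" "b \<in> P" "v \<in> open_segment a b"
    obtain u where u: "a \<noteq> b" "0 < u" "u < 1" "v = (1 - u) *\<^sub>R a + u *\<^sub>R b"
      using ab(3) by (auto simp: in_segment)
    have eq: "x \<bullet> v = (1 - u) * (x \<bullet> a) + u * (x \<bullet> b)"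
      by (simp add: u(4) inner_add_right)
    \<comment> \<open>A proper average of two numbers, each at most \<open>x \<bullet> v\<close>,
      equals \<open>x \<bullet> v\<close> only if both do.\<close>
    have xa: "x \<bullet> a = x \<bullet> v"
    proof (rule antisym[OF max[OF ab(1)]], rule ccontr)
      assume "\<not> x \<bullet> v \<le> x \<bullet> a"
      then have "(1 - u) * (x \<bullet> a) < (1 - u) * (x \<bullet> v)" using u by simp
      moreover have "u * (x \<bullet> b) \<le> u * (x \<bullet> v)" using u max[OF ab(2)] by simp
      ultimately show False using eq by (simp add: algebra_simps)
    qed
    have "u * (x \<bullet> b) = u * (x \<bullet> v)"
      using eq unfolding xa by (simp only: left_diff_distrib mult_1)
    then have "x \<bullet> b = x \<bullet> v" using u by simp
    then have "a = v" "b = v"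
      using normal_cone_interior_unique[OF v(3,2)] ab xa by auto
    then show False using u(1) by simp
  qed
  then have "{v} face_of P" by (simp add: face_of_singleton)
  moreover have "aff_dim \<sigma> = int DIM('a)"
    using v aff_dim_nonempty_interior by blast
  ultimately show "\<sigma> \<in> full_cones P"
    using v(1) by (auto simp: full_cones_def normal_fan_def)
qed

section \<open>Minkowski sums of simplices and normal cones at sums of chosen vertices\<close>

lemma mem_nestohedron_iff:
  "p \<in> nestohedron y B \<longleftrightarrow> (\<exists>s. (\<forall>I\<in>B. s I \<in> simplex_of I) \<and> p = (\<Sum>I\<in>B. y I *\<^sub>R s I))"
proof
  assume "p \<in> nestohedron y B"
  then obtain s where s: "p = (\<Sum>I\<in>B. s I)" "\<forall>I\<in>B. s I \<in> (\<lambda>v. y I *\<^sub>R v) ` simplex_of I"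
    unfolding nestohedron_def by (auto simp: set_sum_alt)
  then have "\<forall>I\<in>B. \<exists>v. v \<in> simplex_of I \<and> s I = y I *\<^sub>R v" by blast
  then obtain s' where "\<forall>I\<in>B. s' I \<in> simplex_of I \<and> s I = y I *\<^sub>R s' I"
    by metis
  then show "\<exists>s. (\<forall>I\<in>B. s I \<in> simplex_of I) \<and> p = (\<Sum>I\<in>B. y I *\<^sub>R s I)"
    using s(1) by (intro exI[of _ s']) (auto intro!: sum.cong)
next
  assume "\<exists>s. (\<forall>I\<in>B. s I \<in> simplex_of I) \<and> p = (\<Sum>I\<in>B. y I *\<^sub>R s I)"
  then show "p \<in> nestohedron y B"
    unfolding nestohedron_def by (auto simp: set_sum_alt)
qed

lemma axis_in_simplex_of: "i \<in> I \<Longrightarrow> axis i 1 \<in> simplex_of I"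
  unfolding simplex_of_def by (simp add: hull_inc)

lemma inner_simplex_of_le:
  fixes x :: "real^'n::finite"
  assumes "p \<in> simplex_of I" "\<And>i. i \<in> I \<Longrightarrow> x $ i \<le> b"
  shows "x \<bullet> p \<le> b"
proof -
  have "simplex_of I \<subseteq> {p. x \<bullet> p \<le> b}"
    unfolding simplex_of_def
    by (rule hull_minimal) (auto simp: inner_axis convex_halfspace_le assms(2))
  then show ?thesis using assms(1) by blast
qed

lemma selection_in_nestohedron:
  assumes "\<And>I. I \<in> B \<Longrightarrow> f I \<in> I"
  shows "(\<Sum>I\<in>B. y I *\<^sub>R axis (f I) 1) \<in> nestohedron y B"
  unfolding mem_nestohedron_iff
  by (intro exI[of _ "\<lambda>I. axis (f I) 1"]) (simp add: assms axis_in_simplex_of)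

text \<open>A functional is maximal on a Minkowski sum at a sum of points exactly when each point is
  maximal on its own summand.\<close>

lemma normal_cone_nestohedron:
  fixes f :: "'n::finite set \<Rightarrow> 'n" and y :: "'n::finite set \<Rightarrow> real"
  assumes y: "\<And>I. I \<in> B \<Longrightarrow> y I > 0" and f: "\<And>I. I \<in> B \<Longrightarrow> f I \<in> I"
  shows "normal_cone (nestohedron y B) {\<Sum>I\<in>B. y I *\<^sub>R axis (f I) 1} =
    {x. \<forall>I\<in>B. \<forall>i\<in>I. x $ i \<le> x $ f I}"
proof (intro subset_antisym subsetI)
  fix x assume x: "x \<in> normal_cone (nestohedron y B) {\<Sum>I\<in>B. y I *\<^sub>R axis (f I) 1}"
  have "x $ i \<le> x $ f J" if J: "J \<in> B" "i \<in> J" for J i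
  proof -
    \<comment> \<open>Changing the choice at \<open>J\<close> alone gives a competing point; the
      other summands cancel and the positive factor \<open>y J\<close> divides out.\<close>
    define g where "g = f(J := i)"
    have "x \<bullet> (\<Sum>I\<in>B. y I *\<^sub>R axis (g I) 1) \<le> x \<bullet> (\<Sum>I\<in>B. y I *\<^sub>R axis (f I) 1)"
    proof -
      have "g I \<in> I" if "I \<in> B" for I
        using J(2) f[OF that] by (simp add: g_def)
      then have "(\<Sum>I\<in>B. y I *\<^sub>R axis (g I) 1) \<in> nestohedron y B"
        by (rule selection_in_nestohedron)
      then show ?thesis using x unfolding normal_cone_def by blast
    qed
    then have "(\<Sum>I\<in>B. y I * x $ g I) \<le> (\<Sum>I\<in>B. y I * x $ f I)"
      by (simp add: inner_sum_right inner_axis)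
    moreover have "(\<Sum>I\<in>B - {J}. y I * x $ g I) = (\<Sum>I\<in>B - {J}. y I * x $ f I)"
      by (intro sum.cong) (auto simp: g_def)
    moreover have rem: "(\<Sum>I\<in>B. y I * x $ h I) = y J * x $ h J + (\<Sum>I\<in>B - {J}. y I * x $ h I)" for h
      using J(1) by (intro sum.remove) auto
    ultimately have "y J * x $ g J \<le> y J * x $ f J"
      using rem[of g] rem[of f] by linarith
    then have "y J * x $ i \<le> y J * x $ f J" by (simp add: g_def)
    then show ?thesis using y[OF J(1)] by simp
  qed
  then show "x \<in> {x. \<forall>I\<in>B. \<forall>i\<in>I. x $ i \<le> x $ f I}" by blast
next
  fix x :: "real^'n" assume x: "x \<in> {x. \<forall>I\<in>B. \<forall>i\<in>I. x $ i \<le> x $ f I}"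
  have "x \<bullet> p \<le> x \<bullet> (\<Sum>I\<in>B. y I *\<^sub>R axis (f I) 1)" if p: "p \<in> nestohedron y B" for p
  proof -
    obtain s where s: "\<forall>I\<in>B. s I \<in> simplex_of I" "p = (\<Sum>I\<in>B. y I *\<^sub>R s I)"
      using p mem_nestohedron_iff by blast
    have "x \<bullet> p = (\<Sum>I\<in>B. y I * (x \<bullet> s I))" by (simp add: s inner_sum_right)
    also have "\<dots> \<le> (\<Sum>I\<in>B. y I * x $ f I)"
    proof (intro sum_mono mult_left_mono)
      fix I assume "I \<in> B"
      then show "x \<bullet> s I \<le> x $ f I" "0 \<le> y I"
        using s(1) x y[of I] by (auto intro!: inner_simplex_of_le)
    qed
    finally show ?thesis by (simp add: inner_sum_right inner_axis)
  qed
  then show "x \<in> normal_cone (nestohedron y B) {\<Sum>I\<in>B. y I *\<^sub>R axis (f I) 1}"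
    by (auto simp: normal_cone_def)
qed

subsection \<open>Cones of ranked weak orders\<close>

text \<open>Coordinates on one level of \<open>h\<close> are not compared, so the associated poset
  is the ordinal sum of the antichains formed by the levels.\<close>

definition rank_cone :: "('n::finite \<Rightarrow> nat) \<Rightarrow> (real^'n) set" where
  "rank_cone h = {x. \<forall>i j. h i < h j \<longrightarrow> x $ i \<le> x $ j}"

text \<open>The point with coordinates \<open>h\<close> is interior: distinct levels differ by at
  least 1, so moving each coordinate by less than 1/2 preserves their order.\<close>

lemma interior_rank_cone_nonempty:
  fixes h :: "'n::finite \<Rightarrow> nat"
  shows "interior (rank_cone h) \<noteq> {}"
proof -
  define c :: "real^'n" where "c = (\<chi> i. real (h i))"
  have "x $ i \<le> x $ j" if x: "dist c x < 1/2" and h: "h i < h j" for x i j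
  proof -
    have "\<bar>(c - x) $ i\<bar> < 1/2" "\<bar>(c - x) $ j\<bar> < 1/2"
      using x component_le_norm_cart[of "c - x" i] component_le_norm_cart[of "c - x" j]
      by (auto simp: dist_norm)
    moreover have "real (h i) + 1 \<le> real (h j)" using h by linarith
    ultimately show ?thesis by (simp add: c_def abs_if split: if_splits)
  qed
  then have "ball c (1/2) \<subseteq> rank_cone h"
    unfolding rank_cone_def by (auto simp only: mem_ball subset_iff mem_Collect_eq)
  then have "c \<in> interior (rank_cone h)"
    unfolding mem_interior by (intro exI[of _ "1/2"]) auto
  then show ?thesis by blast
qed

lemma cone_le_rank_cone:
  fixes h :: "'n::finite \<Rightarrow> nat"
  shows "cone_le (rank_cone h) i j \<longleftrightarrow> i = j \<or> h i < h j"
proof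
  assume le: "cone_le (rank_cone h) i j"
  show "i = j \<or> h i < h j"
  proof (rule ccontr)
    assume *: "\<not> (i = j \<or> h i < h j)"
    \<comment> \<open>Doubling the levels leaves room to raise coordinate \<open>i\<close> by 1
      inside the cone, which puts it above \<open>j\<close> even if both are on one level.\<close>
    define x :: "real^'n" where "x = (\<chi> l. 2 * real (h l) + (if l = i then 1 else 0))"
    have "2 * real (h a) + 2 \<le> 2 * real (h b)" if "h a < h b" for a b
      using that by linarith
    then have "x \<in> rank_cone h" by (fastforce simp: rank_cone_def x_def)
    then have "x $ i \<le> x $ j" using le by (auto simp: cone_le_def)
    then show False using * by (auto simp: x_def)
  qed
qed (auto simp: cone_le_def rank_cone_def)

lemma rank_cone_eqD:
  assumes "rank_cone g = rank_cone h"
  shows "g i < g j \<longleftrightarrow> h i < h j"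
  using cone_le_rank_cone[of g i j] cone_le_rank_cone[of h i j] assms by auto

text \<open>No level is empty, so a jump over a level always has an element in between.\<close>

lemma covered_by_rank_cone:
  assumes "range h = {..m}"
  shows "covered_by (cone_le (rank_cone h)) i j \<longleftrightarrow> h j = Suc (h i)"
proof
  assume c: "covered_by (cone_le (rank_cone h)) i j"
  then have ij: "h i < h j" by (auto simp: covered_by_def cone_le_rank_cone)
  show "h j = Suc (h i)"
  proof (rule ccontr)
    assume "h j \<noteq> Suc (h i)"
    then have "Suc (h i) < h j" using ij by simp
    moreover have "h j \<le> m" using assms by blast
    ultimately have "Suc (h i) \<in> range h" using assms by auto
    then obtain l where "h l = Suc (h i)" by (metis rangeE)
    then have "l \<noteq> i \<and> l \<noteq> j \<and> h i < h l \<and> h l < h j"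
      using \<open>Suc (h i) < h j\<close> by auto
    then show False
      using c by (auto simp: covered_by_def cone_le_rank_cone)
  qed
qed (auto simp: covered_by_def cone_le_rank_cone)

text \<open>With at least two levels the Hasse diagram is connected, so a rank function is determined
  up to an additive constant.\<close>

lemma minimal_rank_rank_cone:
  fixes h :: "'n::finite \<Rightarrow> nat"
  assumes h: "range h = {..m}" and m: "0 < m"
  shows "minimal_rank (cone_le (rank_cone h)) = (\<lambda>x. int (h x))"
proof -
  let ?R = "rank_function (cone_le (rank_cone h))"
  have R: "?R \<rho> \<longleftrightarrow> (\<forall>x. 0 \<le> \<rho> x) \<and> (\<forall>x y. h y = Suc (h x) \<longrightarrow> \<rho> y = \<rho> x + 1)" for \<rho>
    by (simp add: rank_function_def covered_by_rank_cone[OF h])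
  have step: "\<rho> y = \<rho> x + 1" if "?R \<rho>" "h y = Suc (h x)" for \<rho> x y
    using that unfolding R by blast
  have "0 \<in> range h" "1 \<in> range h" using h m by auto
  then obtain z u where z: "h z = 0" and u: "h u = 1" by (metis rangeE)
  have eq: "\<rho> x = int (h x) + \<rho> z" if "?R \<rho>" for \<rho> x
  proof (induction "h x" arbitrary: x)
    case 0
    \<comment> \<open>All elements of level 0 are covered by \<open>u\<close> on level 1, so
      \<open>\<rho>\<close> is constant there. This is where the second level is used.\<close>
    have "\<rho> u = \<rho> l + 1" if "h l = 0" for l
      using step[OF \<open>?R \<rho>\<close>, of u l] u that by simp
    from this[of x] this[of z] show ?case using 0 z by simp
  next
    case (Suc a)
    have "h x \<le> m" using h by blast
    then have "a \<in> range h" using h Suc(2) by auto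
    then obtain w where w: "h w = a" by (metis rangeE)
    then have "\<rho> x = \<rho> w + 1" using step[OF that, of x w] Suc(2) by simp
    then show ?case using Suc(1)[of w] Suc(2) w by simp
  qed
  show ?thesis
    unfolding minimal_rank_def
  proof (rule the_equality)
    show "?R (\<lambda>x. int (h x)) \<and> \<not> ?R (\<lambda>x. int (h x) - 1)"
    proof
      show "?R (\<lambda>x. int (h x))" unfolding R by simp
      have "\<not> 0 \<le> int (h z) - 1" using z by simp
      then show "\<not> ?R (\<lambda>x. int (h x) - 1)" unfolding R by blast
    qed
  next
    fix \<rho> assume \<rho>: "?R \<rho> \<and> \<not> ?R (\<lambda>x. \<rho> x - 1)"
    \<comment> \<open>A positive value at the bottom would make all values positive, and then
      \<open>\<rho> - 1\<close> would still be a rank function.\<close>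
    have "\<rho> z = 0"
    proof (rule ccontr)
      assume "\<rho> z \<noteq> 0"
      moreover have "0 \<le> \<rho> z" using conjunct1[OF \<rho>] unfolding R by blast
      ultimately have "1 \<le> \<rho> z" by simp
      then have "0 \<le> \<rho> x - 1" for x using eq[OF conjunct1[OF \<rho>], of x] by simp
      moreover have "\<rho> y - 1 = \<rho> x - 1 + 1" if "h y = Suc (h x)" for x y
        using step[OF conjunct1[OF \<rho>] that] by simp
      ultimately have "?R (\<lambda>x. \<rho> x - 1)" unfolding R by blast
      then show False using \<rho> by blast
    qed
    then have "\<rho> x = int (h x)" for x
      using eq[OF conjunct1[OF \<rho>], of x] by linarith
    then show "\<rho> = (\<lambda>x. int (h x))" by blast
  qed
qed

subsection \<open>Words and the cones of the nestohedron\<close>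

text \<open>Value 0 is the level of the antichain below the first letter.\<close>

definition word_rank :: "'a list \<Rightarrow> 'a \<Rightarrow> nat" where
  "word_rank w i = (if i \<in> set w then Suc (inv_into {..<length w} ((!) w) i) else 0)"

lemma word_rank_eq_0_iff: "word_rank w i = 0 \<longleftrightarrow> i \<notin> set w"
  by (simp add: word_rank_def)

lemma word_rank_nth:
  assumes "distinct w" "a < length w"
  shows "word_rank w (w ! a) = Suc a"
  using assms by (simp add: word_rank_def inv_into_f_f inj_on_nth)

lemma word_rank_eq_Suc_iff:
  assumes "distinct w"
  shows "word_rank w i = Suc a \<longleftrightarrow> a < length w \<and> w ! a = i"
proof
  assume r: "word_rank w i = Suc a"
  then obtain b where "b < length w" "w ! b = i"
    by (metis in_set_conv_nth nat.distinct(1) word_rank_eq_0_iff)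
  then show "a < length w \<and> w ! a = i" using r word_rank_nth[OF assms, of b] by simp
qed (auto simp: word_rank_nth assms)

text \<open>A letter off the word occupies level 0, so no level is skipped, as the description of
  covers requires.\<close>

lemma range_word_rank:
  assumes "distinct w" "set w \<noteq> UNIV"
  shows "range (word_rank w) = {..length w}"
proof (intro subset_antisym subsetI)
  fix a assume "a \<in> range (word_rank w)"
  then obtain i where "a = word_rank w i" by blast
  then show "a \<in> {..length w}"
    using word_rank_eq_Suc_iff[OF assms(1), of i "a - 1"] by (cases a) auto
next
  fix a assume a: "a \<in> {..length w}"
  show "a \<in> range (word_rank w)"
  proof (cases a)
    case 0
    then show ?thesis using assms(2) word_rank_eq_0_iff[of w] by (metis UNIV_eq_I rangeI)
  next
    case (Suc b)
    then show ?thesis using a word_rank_nth[OF assms(1), of b] by (metis Suc_le_lessD atMost_iff rangeI)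
  qed
qed

text \<open>As no value is skipped, the numbers below \<open>g i\<close> are exactly the values of
  \<open>g\<close> at elements ranked below \<open>i\<close>. By induction \<open>h\<close> has the
  same values there.\<close>

lemma rank_unique:
  fixes g h :: "'a \<Rightarrow> nat"
  assumes g: "range g = {..m}" and h: "range h = {..m'}" and lt: "\<And>i j. g i < g j \<longleftrightarrow> h i < h j"
  shows "g = h"
proof
  fix i
  show "g i = h i"
  proof (induction "g i" arbitrary: i rule: less_induct)
    case less
    have lower: "f ` {j. f j < f i} = {..<f i}" if "range f = {..n}" for f :: "'a \<Rightarrow> nat" and n
    proof (intro subset_antisym subsetI)
      fix a assume a: "a \<in> {..<f i}"
      have "f i \<le> n" using that by blast
      then have "a \<in> range f" using that a by auto
      then show "a \<in> f ` {j. f j < f i}" using a by auto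
    qed auto
    have "{..<g i} = g ` {j. g j < g i}" using lower[OF g] by simp
    also have "\<dots> = h ` {j. h j < h i}"
      using less by (auto simp: lt intro!: image_cong)
    also have "\<dots> = {..<h i}" by (rule lower[OF h])
    finally show ?case by simp
  qed
qed

text \<open>The cone determines the strict order of the levels, hence the levels themselves, and
  these give the position of each letter.\<close>

lemma inj_on_rank_cone_word_rank:
  fixes S :: "'n::finite list set"
  assumes "\<And>w. w \<in> S \<Longrightarrow> distinct w \<and> set w \<noteq> UNIV"
  shows "inj_on (\<lambda>w. rank_cone (word_rank w)) S"
proof (rule inj_onI)
  fix v w assume vw: "v \<in> S" "w \<in> S" "rank_cone (word_rank v) = rank_cone (word_rank w)"
  have dv: "distinct v" "distinct w" and r: "range (word_rank v) = {..length v}" "range (word_rank w) = {..length w}"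
    using vw assms range_word_rank by blast+
  have eq: "word_rank v = word_rank w"
    using rank_unique[OF r rank_cone_eqD[OF vw(3)]] .
  show "v = w"
  proof (rule nth_equalityI)
    show "length v = length w" using r eq by simp
  next
    fix a assume "a < length v"
    then show "v ! a = w ! a"
      using word_rank_eq_Suc_iff[OF dv(2), of "v ! a" a] word_rank_nth[OF dv(1), of a] eq by simp
  qed
qed

text \<open>The word lists the indices of the \<open>m\<close> largest coordinates of
  \<open>x\<close> in increasing order of coordinate, ties being broken by the sorting. Thus the
  cones of words of length \<open>m\<close> cover the space.\<close>

lemma ex_word_rank_cone:
  fixes x :: "real^'n::finite"
  assumes "m \<le> CARD('n)"
  shows "\<exists>w. distinct w \<and> length w = m \<and> x \<in> rank_cone (word_rank w)"
proof -
  obtain us :: "'n list" where us: "set us = UNIV" "distinct us"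
    using finite_distinct_list[of "UNIV :: 'n set"] by auto
  define l where "l = sort_key (\<lambda>i. x $ i) us"
  have l: "set l = UNIV" "distinct l" "sorted (map (\<lambda>i. x $ i) l)"
    using us by (simp_all add: l_def)
  have len: "length l = CARD('n)" using l distinct_card by fastforce
  define d where "d = CARD('n) - m"
  have dw: "distinct (drop d l)" and lw: "length (drop d l) = m"
    using l assms len by (simp_all add: d_def)
  have "x $ i \<le> x $ j" if r: "word_rank (drop d l) i < word_rank (drop d l) j" for i j
  proof -
    obtain b where b: "word_rank (drop d l) j = Suc b" using r by (cases "word_rank (drop d l) j") auto
    then have j: "b < m" "l ! (d + b) = j"
      using word_rank_eq_Suc_iff[OF dw] lw len by (auto simp: d_def)
    obtain c where c: "c < length l" "l ! c = i" using l(1) by (metis UNIV_I in_set_conv_nth)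
    \<comment> \<open>Either \<open>i\<close> is among the \<open>d\<close> discarded indices, or
      its position in the word is \<open>c - d\<close> and the ranks compare positions.\<close>
    have "c < d + b"
    proof (cases "d \<le> c")
      case True
      then have "drop d l ! (c - d) = i" "c - d < m" using c len d_def by auto
      then have "word_rank (drop d l) i = Suc (c - d)"
        using word_rank_nth[OF dw, of "c - d"] lw by simp
      then show ?thesis using r b by simp
    qed simp
    moreover have "d + b < length l" using j(1) len assms by (simp add: d_def)
    ultimately show ?thesis
      using sorted_nth_mono[OF l(3), of c "d + b"] c j by simp
  qed
  then show ?thesis using dw lw by (auto simp: rank_cone_def)
qed

text \<open>Only \<open>k - 1\<close> indices lie off the word, so each member of the family has a
  unique element of largest rank. Choosing it everywhere gives the vertex \<open>v\<close>.\<close>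

lemma nestohedron_family_B_vertex:
  fixes y :: "'n::finite set \<Rightarrow> real"
  assumes y: "\<And>I. I \<in> family_B k \<Longrightarrow> y I > 0"
    and w: "distinct w" "length w + k = CARD('n) + 1" and k: "0 < k"
  shows "\<exists>v\<in>nestohedron y (family_B k).
    normal_cone (nestohedron y (family_B k)) {v} = rank_cone (word_rank w)"
proof -
  have "\<exists>s\<in>I. \<forall>i\<in>I. i \<noteq> s \<longrightarrow> word_rank w i < word_rank w s" if I: "I \<in> family_B k" for I :: "'n set"
  proof -
    have "I \<noteq> {}" using I k by (auto simp: family_B_def)
    then have "Max (word_rank w ` I) \<in> word_rank w ` I" by (intro Max_in) auto
    then obtain s where s: "s \<in> I" "word_rank w s = Max (word_rank w ` I)" by auto
    have le: "word_rank w i \<le> word_rank w s" if "i \<in> I" for i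
      using that by (simp add: s(2))
    have "word_rank w i \<noteq> word_rank w s" if i: "i \<in> I" "i \<noteq> s" for i
    proof
      assume eq: "word_rank w i = word_rank w s"
      show False
      proof (cases "word_rank w s")
        case 0
        \<comment> \<open>Maximum 0 means that \<open>I\<close> avoids the word and has fewer than
          \<open>k\<close> elements. It would then be a singleton, against
          \<open>i \<noteq> s\<close>.\<close>
        then have "I \<subseteq> - set w" using le word_rank_eq_0_iff[of w] by fastforce
        then have "card I \<le> card (- set w)" by (intro card_mono) auto
        also have "card (- set w) < k"
          using w(2) k distinct_card[OF w(1)] by (simp add: Compl_eq_Diff_UNIV card_Diff_subset)
        finally show False using I i s(1) by (auto simp: family_B_def)
      next
        case (Suc a)
        then show False using eq i(2) word_rank_eq_Suc_iff[OF w(1)] by metis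
      qed
    qed
    then show ?thesis using s(1) le by (metis le_neq_implies_less)
  qed
  then obtain f where f: "\<And>I. I \<in> family_B k \<Longrightarrow> f I \<in> I"
    "\<And>I i. I \<in> family_B k \<Longrightarrow> i \<in> I \<Longrightarrow> i \<noteq> f I \<Longrightarrow> word_rank w i < word_rank w (f I)"
    by metis
  have "{x. \<forall>I\<in>family_B k. \<forall>i\<in>I. x $ i \<le> x $ f I} = rank_cone (word_rank w)" (is "?N = _")
  proof (intro subset_antisym subsetI)
    fix x assume "x \<in> rank_cone (word_rank w)"
    then show "x \<in> ?N" using f(2) by (fastforce simp: rank_cone_def)
  next
    fix x assume x: "x \<in> ?N"
    have "x $ i \<le> x $ j" if r: "word_rank w i < word_rank w j" for i j
    proof -
      \<comment> \<open>This down-set contains \<open>j\<close> and the \<open>k - 1\<close> indices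
        off the word, so it belongs to the family, and its chosen element is \<open>j\<close>. Its
        inequalities are the ones needed.\<close>
      define I where "I = {l. word_rank w l \<le> word_rank w j}"
      obtain a where a: "word_rank w j = Suc a" using r by (cases "word_rank w j") auto
      then have aj: "a < length w" "w ! a = j" using word_rank_eq_Suc_iff[OF w(1)] by auto
      have "- I \<subseteq> set (drop (Suc a) w)"
      proof
        fix l assume "l \<in> - I"
        then have "Suc a < word_rank w l" using a by (simp add: I_def)
        then obtain b where b: "word_rank w l = Suc b" "a < b" by (cases "word_rank w l") auto
        then have "b < length w" "w ! b = l" using word_rank_eq_Suc_iff[OF w(1)] by auto
        then have "drop (Suc a) w ! (b - Suc a) = l" "b - Suc a < length (drop (Suc a) w)"
          using b(2) by auto
        then show "l \<in> set (drop (Suc a) w)" by (metis nth_mem)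
      qed
      then have "card (- I) \<le> length w - Suc a"
        by (metis List.finite_set card_length card_mono le_trans length_drop)
      then have "k \<le> card I" using w(2) aj(1) card_mono[of UNIV I] by (simp add: Compl_eq_Diff_UNIV card_Diff_subset)
      then have IB: "I \<in> family_B k" by (simp add: family_B_def)
      have "j \<in> I" "i \<in> I" using r by (simp_all add: I_def)
      moreover have "f I = j"
        using f[OF IB] \<open>j \<in> I\<close> by (force simp: I_def)
      ultimately show ?thesis using x IB by auto
    qed
    then show "x \<in> rank_cone (word_rank w)" by (simp add: rank_cone_def)
  qed
  then have "normal_cone (nestohedron y (family_B k)) {\<Sum>I\<in>family_B k. y I *\<^sub>R axis (f I) 1} =
      rank_cone (word_rank w)"
    using normal_cone_nestohedron[OF y f(1)] by simp
  with selection_in_nestohedron[OF f(1)] show ?thesis by blast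
qed

text \<open>An interior functional of any full-dimensional cone also lies in the cone of some word.
  That is the normal cone of some \<open>u\<close>, and uniqueness of the maximizer identifies
  \<open>u\<close> with \<open>v\<close>.\<close>

lemma full_cones_nestohedron_family_B:
  fixes y :: "'n::finite set \<Rightarrow> real"
  assumes y: "\<And>I. I \<in> family_B k \<Longrightarrow> y I > 0" and m: "m + k = CARD('n) + 1" and k: "0 < k"
  shows "full_cones (nestohedron y (family_B k)) =
    (\<lambda>w. rank_cone (word_rank w)) ` {w. distinct w \<and> length w = m}"
proof (intro subset_antisym subsetI)
  let ?P = "nestohedron y (family_B k)"
  fix \<sigma> assume "\<sigma> \<in> full_cones ?P"
  then obtain v x where v: "\<sigma> = normal_cone ?P {v}" "v \<in> ?P" "x \<in> interior (normal_cone ?P {v})"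
    unfolding full_cones_eq by blast
  obtain w where w: "distinct w" "length w = m" "x \<in> rank_cone (word_rank w)"
    using ex_word_rank_cone[of m x] m k by auto
  obtain u where u: "u \<in> ?P" "normal_cone ?P {u} = rank_cone (word_rank w)"
    using nestohedron_family_B_vertex[of k y w, OF y w(1) _ k] w(2) m by auto
  have "x \<in> normal_cone ?P {v}" "x \<in> normal_cone ?P {u}"
    using v(3) interior_subset w(3) u(2) by auto
  then have "x \<bullet> u = x \<bullet> v"
    using u(1) v(2) by (intro antisym) (auto simp: normal_cone_def)
  then have "u = v" using normal_cone_interior_unique v u by blast
  then show "\<sigma> \<in> (\<lambda>w. rank_cone (word_rank w)) ` {w. distinct w \<and> length w = m}"
    using u(2) v(1) w by blast
next
  fix \<sigma> assume "\<sigma> \<in> (\<lambda>w. rank_cone (word_rank w)) ` {w :: 'n list. distinct w \<and> length w = m}"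
  then obtain w :: "'n list" where w: "\<sigma> = rank_cone (word_rank w)" "distinct w" "length w = m" by blast
  obtain u where "u \<in> nestohedron y (family_B k)"
      "normal_cone (nestohedron y (family_B k)) {u} = rank_cone (word_rank w)"
    using nestohedron_family_B_vertex[of k y w, OF y w(2) _ k] w(3) m by auto
  then show "\<sigma> \<in> full_cones (nestohedron y (family_B k))"
    unfolding full_cones_eq using w(1) interior_rank_cone_nonempty by fastforce
qed

subsection \<open>Descents\<close>

text \<open>Covers either lead from an index off the word to its first letter or join consecutive
  letters. The weight \<open>f\<close> is arbitrary so that both \<open>des\<close> and
  \<open>maj\<close> can be read off.\<close>

lemma sum_poset_Des_rank_cone:
  fixes w :: "'n::{finite,linorder} list"
  assumes w: "distinct w" "set w \<noteq> UNIV" "w \<noteq> []"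
  shows "sum f (poset_Des (cone_le (rank_cone (word_rank w)))) =
    (\<Sum>i | i \<notin> set w \<and> hd w < i. f (i, hd w)) + (\<Sum>a\<in>word_Des w. f (w ! (a - 1), w ! a))"
proof -
  let ?X = "(\<lambda>i. (i, hd w)) ` {i. i \<notin> set w \<and> hd w < i}"
  let ?Y = "(\<lambda>a. (w ! (a - 1), w ! a)) ` word_Des w"
  have hd: "hd w = w ! 0" "0 < length w" using w(3) by (simp_all add: hd_conv_nth)
  have Q: "poset_Des (cone_le (rank_cone (word_rank w))) =
      {(i, j). word_rank w j = Suc (word_rank w i) \<and> j < i}"
    by (simp add: poset_Des_def covered_by_rank_cone[OF range_word_rank[OF w(1,2)]])
  also have "\<dots> = ?X \<union> ?Y"
  proof (intro subset_antisym subsetI)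
    fix p assume "p \<in> {(i, j). word_rank w j = Suc (word_rank w i) \<and> j < i}"
    then obtain i j where p: "p = (i, j)" "word_rank w j = Suc (word_rank w i)" "j < i" by blast
    have j: "word_rank w i < length w" "w ! word_rank w i = j"
      using p(2) word_rank_eq_Suc_iff[OF w(1)] by auto
    show "p \<in> ?X \<union> ?Y"
    proof (cases "word_rank w i")
      case 0
      then have "p \<in> ?X" using j p hd word_rank_eq_0_iff[of w i] by auto
      then show ?thesis by blast
    next
      case (Suc a)
      then have "w ! a = i" using word_rank_eq_Suc_iff[OF w(1)] by auto
      then have "p = (w ! (Suc a - 1), w ! Suc a)" "Suc a \<in> word_Des w"
        using p j Suc by (auto simp: word_Des_def)
      then show ?thesis by blast
    qed
  next
    fix p assume "p \<in> ?X \<union> ?Y"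
    then show "p \<in> {(i, j). word_rank w j = Suc (word_rank w i) \<and> j < i}"
    proof
      assume "p \<in> ?X"
      then show ?thesis
        using hd word_rank_nth[OF w(1), of 0] word_rank_eq_0_iff[of w] by auto
    next
      assume "p \<in> ?Y"
      then obtain a where a: "p = (w ! (a - 1), w ! a)" "a \<in> word_Des w" by blast
      then have "1 \<le> a" "a < length w" "w ! a < w ! (a - 1)" by (auto simp: word_Des_def)
      then show ?thesis
        using a(1) word_rank_nth[OF w(1), of a] word_rank_nth[OF w(1), of "a - 1"] by auto
    qed
  qed
  finally have eq: "poset_Des (cone_le (rank_cone (word_rank w))) = ?X \<union> ?Y" .
  have fin: "finite (word_Des w)" by (simp add: word_Des_def)
  have disj: "?X \<inter> ?Y = {}"
  proof -
    have "w ! (a - 1) \<in> set w" if "a \<in> word_Des w" for a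
      using that by (auto simp: word_Des_def)
    then show ?thesis by auto
  qed
  have "inj_on (\<lambda>a. (w ! (a - 1), w ! a)) (word_Des w)"
    using w(1) by (auto simp: inj_on_def word_Des_def nth_eq_iff_index_eq)
  then show ?thesis
    unfolding eq using fin disj
    by (subst sum.union_disjoint) (auto simp: sum.reindex inj_on_def)
qed

lemma poset_des_rank_cone:
  fixes w :: "'n::{finite,linorder} list"
  assumes "distinct w" "set w \<noteq> UNIV" "w \<noteq> []"
  shows "poset_des (cone_le (rank_cone (word_rank w))) =
    word_des w + card {i. i \<notin> set w \<and> hd w < i}"
  using sum_poset_Des_rank_cone[OF assms, of "\<lambda>_. 1::nat"]
  by (simp add: poset_des_def word_des_def)

lemma poset_maj_rank_cone:
  fixes w :: "'n::{finite,linorder} list"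
  assumes w: "distinct w" "set w \<noteq> UNIV" "w \<noteq> []"
  shows "poset_maj (cone_le (rank_cone (word_rank w))) =
    word_maj w + word_des w + card {i. i \<notin> set w \<and> hd w < i}"
proof -
  have "poset_maj (cone_le (rank_cone (word_rank w))) =
      (\<Sum>p\<in>poset_Des (cone_le (rank_cone (word_rank w))). word_rank w (snd p))"
    using w by (simp add: poset_maj_def minimal_rank_rank_cone[OF range_word_rank[OF w(1,2)]]
        split_def)
  also have "\<dots> = (\<Sum>i | i \<notin> set w \<and> hd w < i. word_rank w (hd w)) +
      (\<Sum>a\<in>word_Des w. word_rank w (w ! a))"
    by (simp add: sum_poset_Des_rank_cone[OF w])
  also have "word_rank w (hd w) = 1"
    using word_rank_nth[OF w(1), of 0] w(3) by (simp add: hd_conv_nth)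
  also have "(\<Sum>a\<in>word_Des w. word_rank w (w ! a)) = word_maj w + word_des w"
  proof -
    \<comment> \<open>A descent at position \<open>a\<close>, counted from 1, ends in
      \<open>w ! a\<close>, which is letter number \<open>a + 1\<close>. The extra 1 per descent
      produces the summand \<open>word_des w\<close>.\<close>
    have "(\<Sum>a\<in>word_Des w. word_rank w (w ! a)) = (\<Sum>a\<in>word_Des w. a + 1)"
      by (intro sum.cong) (auto simp: word_Des_def word_rank_nth w(1))
    also have "\<dots> = word_maj w + word_des w"
      by (simp only: sum.distrib word_maj_def word_des_def sum_constant mult_1_right of_nat_id)
    finally show ?thesis .
  qed
  finally show ?thesis by simp
qed

lemma q_h_poly_family_B:
  fixes y :: "'n::{finite,linorder} set \<Rightarrow> real"
  assumes y: "\<And>I. I \<in> family_B k \<Longrightarrow> y I > 0" and m: "m + k = CARD('n) + 1" and k: "2 \<le> k"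
    and "0 < m"
  shows "q_h_poly y (family_B k) = (\<Sum>w | distinct w \<and> length w = m.
      tq_monom (word_des w + card {i. i \<notin> set w \<and> hd w < i})
        (word_maj w + word_des w + card {i. i \<notin> set w \<and> hd w < (i::'n)}))"
proof -
  \<comment> \<open>\<open>0 < m\<close> provides a first letter, and \<open>2 \<le> k\<close>
    leaves at least one index off the word.\<close>
  have w: "w \<noteq> []" "set w \<noteq> UNIV" if "distinct w" "length w = m" for w :: "'n list"
    using that distinct_card[OF that(1)] m k \<open>0 < m\<close> by auto
  have "q_h_poly y (family_B k) =
      (\<Sum>\<sigma>\<in>(\<lambda>w. rank_cone (word_rank w)) ` {w :: 'n list. distinct w \<and> length w = m}.
        tq_monom (poset_des (cone_le \<sigma>)) (poset_maj (cone_le \<sigma>)))"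
    unfolding q_h_poly_def using full_cones_nestohedron_family_B[OF y m] k by simp
  also have "\<dots> = (\<Sum>w | distinct w \<and> length w = m.
      tq_monom (poset_des (cone_le (rank_cone (word_rank (w :: 'n list)))))
        (poset_maj (cone_le (rank_cone (word_rank w)))))"
    by (subst sum.reindex) (auto intro!: inj_on_rank_cone_word_rank dest: w(2))
  also have "\<dots> = (\<Sum>w | distinct w \<and> length w = m.
      tq_monom (word_des w + card {i. i \<notin> set w \<and> hd w < i})
        (word_maj w + word_des w + card {i. i \<notin> set w \<and> hd w < (i::'n)}))"
    using w by (intro sum.cong) (auto simp: poset_des_rank_cone poset_maj_rank_cone)
  finally show ?thesis .
qed

subsection \<open>Symmetry\<close>

lemma tq_eval_add: "tq_eval (p + p') t q = tq_eval p t q + tq_eval p' t q"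
proof -
  have "map_poly (map_poly of_int :: int poly \<Rightarrow> 'a poly) (p + p') =
      map_poly (map_poly of_int) p + map_poly (map_poly of_int) p'"
    by (intro poly_eqI) (simp add: coeff_map_poly poly_eq_iff)
  then show ?thesis by (simp add: tq_eval_def)
qed

lemma tq_eval_sum: "tq_eval (\<Sum>x\<in>S. f x) t q = (\<Sum>x\<in>S. tq_eval (f x) t q)"
proof (induction S rule: infinite_finite_induct)
  case (insert x S)
  then show ?case by (simp add: tq_eval_add)
qed (simp_all add: tq_eval_def)

lemma tq_eval_tq_monom: "tq_eval (tq_monom a b) t q = t ^ a * q ^ b"
  by (simp add: tq_eval_def tq_monom_def map_poly_monom poly_monom poly_mult poly_power mult.commute)

text \<open>On an abstract finite linear order the reversal is built by counting: \<open>r i\<close>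
  has as many elements below it as \<open>i\<close> has above it.\<close>

lemma ex_antitone_bij:
  "\<exists>r :: 'n::{finite,linorder} \<Rightarrow> 'n. bij r \<and> (\<forall>i j. r i < r j \<longleftrightarrow> j < i)"
proof -
  define c d :: "'n \<Rightarrow> nat" where "c i = card {j. j < i}" and "d i = card {j. i < j}" for i
  have c: "c i < c j" if "i < j" for i j
    unfolding c_def using that by (intro psubset_card_mono) auto
  have d: "d j < d i" if "i < j" for i j
    unfolding d_def using that by (intro psubset_card_mono) auto
  have inj: "inj c" "inj d"
    using c d by (metis injI less_irrefl linorder_neqE)+
  have img: "c ` UNIV = {..<CARD('n)}" "d ` UNIV = {..<CARD('n)}"
    using inj unfolding c_def d_def
    by (intro card_subset_eq; auto intro!: psubset_card_mono simp: card_image)+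
  define r where "r i = inv_into UNIV c (d i)" for i
  have cr: "c (r i) = d i" for i
    unfolding r_def using img by (intro f_inv_into_f) auto
  have ciff: "c i < c j \<longleftrightarrow> i < j" for i j
    using c by (metis less_asym less_linear)
  have diff: "d i < d j \<longleftrightarrow> j < i" for i j
    using d by (metis less_asym less_linear)
  have "r i < r j \<longleftrightarrow> j < i" for i j
    using ciff[of "r i" "r j"] diff[of i j] cr by simp
  moreover have "inj r" using cr inj(2) by (metis injD injI)
  then have "bij r" by (simp add: bij_def finite_UNIV_inj_surj)
  ultimately show ?thesis by blast
qed

text \<open>Adjacent letters are distinct, so each position is a descent of exactly one of the two
  words.\<close>

lemma word_Des_map_antitone:
  assumes r: "\<And>i j. r i < r j \<longleftrightarrow> j < (i::'a::linorder)" and "distinct w"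
  shows "word_Des (map r w) = {1..<length w} - word_Des w"
proof -
  have "map r w ! i < map r w ! (i - 1) \<longleftrightarrow> \<not> w ! i < w ! (i - 1)" if "i \<in> {1..<length w}" for i
  proof -
    have "w ! (i - 1) \<noteq> w ! i"
      using that assms(2) by (auto simp: nth_eq_iff_index_eq)
    then show ?thesis
      using that r[of "w ! i" "w ! (i - 1)"] by auto
  qed
  then show ?thesis unfolding word_Des_def length_map by blast
qed

lemma word_Des_subset: "word_Des w \<subseteq> {1..<length w}"
  by (auto simp: word_Des_def)

lemma word_des_map_antitone:
  assumes "\<And>i j. r i < r j \<longleftrightarrow> j < (i::'a::linorder)" "distinct w"
  shows "word_des w + word_des (map r w) = length w - 1"
proof -
  have "word_des (map r w) = card {1..<length w} - word_des w"
    unfolding word_des_def word_Des_map_antitone[OF assms]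
    by (intro card_Diff_subset word_Des_subset) (auto intro: finite_subset[OF word_Des_subset])
  moreover have "word_des w \<le> card {1..<length w}"
    unfolding word_des_def by (intro card_mono word_Des_subset) auto
  ultimately show ?thesis by simp
qed

lemma word_maj_map_antitone:
  assumes "\<And>i j. r i < r j \<longleftrightarrow> j < (i::'a::linorder)" "distinct w"
  shows "word_maj w + word_maj (map r w) = \<Sum>{1..<length w}"
  unfolding word_maj_def word_Des_map_antitone[OF assms]
  using sum.subset_diff[OF word_Des_subset[of w], of "\<lambda>i. i"] by simp

text \<open>Reversal turns the indices above the first letter into those below it. Together these
  are all indices off the word, none of which equals that letter.\<close>

lemma card_above_hd_map_antitone:
  fixes r :: "'n::{finite,linorder} \<Rightarrow> 'n"
  assumes r: "\<And>i j. r i < r j \<longleftrightarrow> j < i" "bij r" and w: "distinct w" "w \<noteq> []"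
  shows "card {i. i \<notin> set w \<and> hd w < i} + card {i. i \<notin> set (map r w) \<and> hd (map r w) < i}
    = CARD('n) - length w"
proof -
  have hd: "hd w \<in> set w" using w(2) by simp
  have "r i \<notin> set (map r w) \<and> hd (map r w) < r i \<longleftrightarrow> i \<notin> set w \<and> i < hd w" for i
    using w(2) by (simp add: hd_map r(1) inj_image_mem_iff[OF bij_is_inj[OF r(2)]])
  then have "r -` {i. i \<notin> set (map r w) \<and> hd (map r w) < i} = {i. i \<notin> set w \<and> i < hd w}"
    by (simp only: vimage_def mem_Collect_eq)
  from surj_image_vimage_eq[OF bij_is_surj[OF r(2)], of "{i. i \<notin> set (map r w) \<and> hd (map r w) < i}",
      unfolded this]
  have "{i. i \<notin> set (map r w) \<and> hd (map r w) < i} = r ` {i. i \<notin> set w \<and> i < hd w}" ..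
  then have "card {i. i \<notin> set (map r w) \<and> hd (map r w) < i} = card {i. i \<notin> set w \<and> i < hd w}"
    using bij_is_inj[OF r(2)] by (simp add: card_image inj_on_subset)
  moreover have "card ({i. i \<notin> set w \<and> hd w < i} \<union> {i. i \<notin> set w \<and> i < hd w}) =
      card {i. i \<notin> set w \<and> hd w < i} + card {i. i \<notin> set w \<and> i < hd w}"
    by (intro card_Un_disjoint) auto
  moreover have "{i. i \<notin> set w \<and> hd w < i} \<union> {i. i \<notin> set w \<and> i < hd w} = - set w"
  proof (intro subset_antisym subsetI)
    fix i assume "i \<in> - set w"
    then have "i \<noteq> hd w" using hd by blast
    then show "i \<in> {i. i \<notin> set w \<and> hd w < i} \<union> {i. i \<notin> set w \<and> i < hd w}"
      using \<open>i \<in> - set w\<close> by (simp add: neq_iff disj_commute)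
  qed auto
  ultimately show ?thesis using distinct_card[OF w(1)] by (simp add: Compl_eq_Diff_UNIV card_Diff_subset)
qed

text \<open>Complementary exponents turn the term of \<open>x\<close> into
  \<open>t ^ M * q ^ N\<close> times the inverted term of \<open>\<phi> x\<close>; reindexing along
  \<open>\<phi>\<close> gives the whole sum.\<close>

lemma tq_eval_reciprocal:
  fixes t q :: "'a::field"
  assumes "t \<noteq> 0" "q \<noteq> 0" and bij: "bij_betw \<phi> S S"
    and a: "\<And>x. x \<in> S \<Longrightarrow> a x + a (\<phi> x) = M"
    and b: "\<And>x. x \<in> S \<Longrightarrow> b x + b (\<phi> x) = N"
  shows "tq_eval (\<Sum>x\<in>S. tq_monom (a x) (b x)) t q =
    t ^ M * q ^ N * tq_eval (\<Sum>x\<in>S. tq_monom (a x) (b x)) (inverse t) (inverse q)"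
proof -
  have "t ^ a x * q ^ b x = t ^ M * q ^ N * (inverse t ^ a (\<phi> x) * inverse q ^ b (\<phi> x))"
    if "x \<in> S" for x
    using assms(1,2) a[OF that, symmetric] b[OF that, symmetric]
    by (simp add: power_add power_inverse field_simps)
  then have "(\<Sum>x\<in>S. t ^ a x * q ^ b x) =
      t ^ M * q ^ N * (\<Sum>x\<in>S. inverse t ^ a (\<phi> x) * inverse q ^ b (\<phi> x))"
    by (simp add: sum_distrib_left)
  also have "(\<Sum>x\<in>S. inverse t ^ a (\<phi> x) * inverse q ^ b (\<phi> x)) =
      (\<Sum>x\<in>S. inverse t ^ a x * inverse q ^ b x)"
    using sum.reindex_bij_betw[OF bij, of "\<lambda>x. inverse t ^ a x * inverse q ^ b x"] .
  finally show ?thesis by (simp add: tq_eval_sum tq_eval_tq_monom)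
qed

theorem theorem5p2:
  fixes n k :: nat and y :: "'n::{finite,linorder} set \<Rightarrow> real"
  assumes "CARD('n) = n" and "2 \<le> k" and "k \<le> n"
    and "\<And>I. I \<in> family_B k \<Longrightarrow> y I > 0"
  shows "q_h_poly y (family_B k) =
      (\<Sum>A\<in>{A :: 'n set. card A = n - k + 1}. \<Sum>\<pi>\<in>permutations_of_set A.
        tq_monom (word_des \<pi> + card {j. j \<notin> A \<and> j > hd \<pi>})
          (word_maj \<pi> + word_des \<pi> + card {j. j \<notin> A \<and> j > hd \<pi>}))
    \<and> (\<forall>t q :: 'a::field. t \<noteq> 0 \<longrightarrow> q \<noteq> 0 \<longrightarrow>
        tq_eval (q_h_poly y (family_B k)) t q =
          t ^ (n - 1)
          * q powi (((int k)^2 - 2 * int k * int n - int k + (int n)^2 + 3 * int n - 2) div 2)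
          * tq_eval (q_h_poly y (family_B k)) (inverse t) (inverse q))"
proof (intro conjI allI impI)
  define m where "m = n - k + 1"
  define S where "S = {w :: 'n list. distinct w \<and> length w = m}"
  define a b where "a w = word_des w + card {j. j \<notin> set w \<and> j > hd w}"
    and "b w = word_maj w + word_des w + card {j. j \<notin> set w \<and> j > hd w}" for w :: "'n list"
  have m: "m + k = CARD('n) + 1" "0 < m" using assms(1,3) by (simp_all add: m_def)
  have h: "q_h_poly y (family_B k) = (\<Sum>w\<in>S. tq_monom (a w) (b w))"
    unfolding S_def a_def b_def by (rule q_h_poly_family_B[OF assms(4) m(1) assms(2) m(2)])
  \<comment> \<open>Grouping the words by their set of letters gives the double sum.\<close>
  have S: "S = (\<Union>A\<in>{A. card A = m}. permutations_of_set A)"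
    by (auto simp: S_def permutations_of_set_def distinct_card)
  have "(\<Sum>w\<in>S. tq_monom (a w) (b w)) =
      (\<Sum>A\<in>{A. card A = m}. \<Sum>w\<in>permutations_of_set A. tq_monom (a w) (b w))"
    unfolding S by (intro sum.UNION_disjoint) (auto dest: permutations_of_setD(1))
  also have "\<dots> = (\<Sum>A\<in>{A :: 'n set. card A = m}. \<Sum>\<pi>\<in>permutations_of_set A.
        tq_monom (word_des \<pi> + card {j. j \<notin> A \<and> j > hd \<pi>})
          (word_maj \<pi> + word_des \<pi> + card {j. j \<notin> A \<and> j > hd \<pi>}))"
    by (intro sum.cong refl) (simp add: a_def b_def permutations_of_setD(1))
  finally show "q_h_poly y (family_B k) =
      (\<Sum>A\<in>{A :: 'n set. card A = n - k + 1}. \<Sum>\<pi>\<in>permutations_of_set A.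
        tq_monom (word_des \<pi> + card {j. j \<notin> A \<and> j > hd \<pi>})
          (word_maj \<pi> + word_des \<pi> + card {j. j \<notin> A \<and> j > hd \<pi>}))"
    using h by (simp add: m_def)
  fix t q :: 'a assume tq: "t \<noteq> 0" "q \<noteq> 0"
  obtain r :: "'n \<Rightarrow> 'n" where r: "\<And>i j. r i < r j \<longleftrightarrow> j < i" "bij r"
    using ex_antitone_bij by blast
  have inj: "inj_on (map r) S"
    using bij_is_inj[OF r(2)] by (simp add: inj_on_subset[of _ UNIV])
  have finS: "finite S"
    unfolding S by auto
  have "map r ` S \<subseteq> S"
    using bij_is_inj[OF r(2)] by (auto simp: S_def distinct_map intro: inj_on_subset[OF _ subset_UNIV])
  then have bij: "bij_betw (map r) S S"
    using inj finS by (simp add: bij_betw_def endo_inj_surj)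
  \<comment> \<open>The three summands are the totals, over a word and its reversal, of
    \<open>word_maj\<close>, of \<open>word_des\<close> and of the number of outside indices above
    the first letter.\<close>
  define N where "N = \<Sum>{1..<m} + (m - 1) + (k - 1)"
  have stat: "a w + a (map r w) = n - 1" "b w + b (map r w) = N" if "w \<in> S" for w
  proof -
    have w: "distinct w" "length w = m" "w \<noteq> []" using that m(2) by (auto simp: S_def)
    note st = word_des_map_antitone[OF r(1) w(1)] word_maj_map_antitone[OF r(1) w(1)]
      card_above_hd_map_antitone[OF r w(1,3)]
    have "CARD('n) - length w = k - 1" "(m - 1) + (k - 1) = n - 1"
      using m assms w by auto
    then show "a w + a (map r w) = n - 1" "b w + b (map r w) = N"
      using st w(2) by (simp_all add: a_def b_def N_def)
  qed
  have "2 * int (\<Sum>{1..<m}) = int m * (int m - 1)"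
  proof -
    have "2 * int (\<Sum>{1..<j}) = int j * (int j - 1)" for j
      by (induction j) (auto simp: algebra_simps)
    then show ?thesis .
  qed
  moreover have "int m = int n - int k + 1" using assms(3) by (simp add: m_def)
  ultimately have "2 * int N = (int k)^2 - 2 * int k * int n - int k + (int n)^2 + 3 * int n - 2"
    using assms(2) m(2) by (simp add: N_def of_nat_diff algebra_simps power2_eq_square)
  \<comment> \<open>The numerator is twice a natural number, so the division is exact and the
    integer power is an ordinary one.\<close>
  then have N: "((int k)^2 - 2 * int k * int n - int k + (int n)^2 + 3 * int n - 2) div 2 = int N"
    by simp
  show "tq_eval (q_h_poly y (family_B k)) t q = t ^ (n - 1)
      * q powi (((int k)^2 - 2 * int k * int n - int k + (int n)^2 + 3 * int n - 2) div 2)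
      * tq_eval (q_h_poly y (family_B k)) (inverse t) (inverse q)"
    unfolding h N power_int_of_nat by (rule tq_eval_reciprocal[where a = a and b = b, OF tq bij stat])
qed

end
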